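(* A countable infinite commutative semigroup admits an invariant measure if and only if it is isomorphic to $(\mathbb{Q},\min)$, the rationals with the operation $(q,r)\mapsto\min(q,r)$.
   Context: A semigroup is viewed as a structure in the language $L$ with a single binary function symbol. A countable infinite $L$-structure $\mathcal{M}$ admits an invariant measure if there is a probability measure on $S_L$ (the space of $L$-structures with underlying set $\mathbb{N}$, with the Borel $\sigma$-algebra generated by the sets $\{\mathcal{N}: f^{\mathcal{N}}(n_1,n_2)=\ell\}$), invariant under the logic action of $\mathrm{Sym}(\mathbb{N})$ induced by permuting $\mathbb{N}$, that gives measure $1$ to the set of structures in $S_L$ isomorphic to $\mathcal{M}$. *)

theory Defs
  imports "HOL-Probability.Probability"
begin

definition op_isomorphic :: "('a \<Rightarrow> 'a \<Rightarrow> 'a) \<Rightarrow> ('b \<Rightarrow> 'b \<Rightarrow> 'b) \<Rightarrow> bool" where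
  "op_isomorphic f g \<longleftrightarrow>
     (\<exists>h :: 'a \<Rightarrow> 'b. bij h \<and> (\<forall>x y. h (f x y) = g (h x) (h y)))"

text \<open>
  Structures with underlying set \<open>\<nat>\<close> for the language with one binary function symbol are
  identified with the interpretations \<open>nat \<Rightarrow> nat \<Rightarrow> nat\<close> of that symbol.
\<close>

definition S_L :: "(nat \<Rightarrow> nat \<Rightarrow> nat) measure" where
  "S_L = sigma UNIV {{F. F m n = l} | m n l. True}"

definition logic_action :: "(nat \<Rightarrow> nat) \<Rightarrow> (nat \<Rightarrow> nat \<Rightarrow> nat) \<Rightarrow> (nat \<Rightarrow> nat \<Rightarrow> nat)" where
  "logic_action p F = (\<lambda>m n. p (F (inv p m) (inv p n)))"

definition Sym_invariant :: "(nat \<Rightarrow> nat \<Rightarrow> nat) measure \<Rightarrow> bool" where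
  "Sym_invariant \<mu> \<longleftrightarrow>
     (\<forall>p. bij p \<longrightarrow> (\<forall>A\<in>sets \<mu>. emeasure \<mu> (logic_action p ` A) = emeasure \<mu> A))"

text \<open>
  Since \<^const>\<open>emeasure\<close> is 0 outside the \<open>\<sigma>\<close>-algebra, the last conjunct below includes the
  measurability of the isomorphism class.
\<close>

definition admits_invariant_measure :: "('a \<Rightarrow> 'a \<Rightarrow> 'a) \<Rightarrow> bool" where
  "admits_invariant_measure f \<longleftrightarrow>
     (\<exists>\<mu>. prob_space \<mu> \<and> sets \<mu> = sets S_L \<and> Sym_invariant \<mu> \<and>
          emeasure \<mu> {F. op_isomorphic F f} = 1)"

end

theory Submission imports Defs begin

text \<open>
  Let \<open>\<mu>\<close> be an invariant measure for \<open>f\<close>. If an element \<open>l\<close> outside a finite set \<open>A\<close> is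
  definable over \<open>A\<close>, then by invariance all elements outside \<open>A\<close> are equally likely to be the
  defined one, so almost surely none is. Applied to \<open>l = F m n\<close> over \<open>{m, n}\<close>, this
  shows that the operation is almost surely the minimum of a linear order; applied to the least
  element, the greatest element and the immediate successor of \<open>m\<close>, it shows that this order is
  dense without endpoints, and Cantor's theorem identifies it with the rationals. Conversely, an
  i.i.d. sequence of normal variables is almost surely injective with dense range, so the order
  that it induces on the indices gives an invariant measure for the minimum on the rationals.
\<close>

section \<open>Countable dense linear orders\<close>

text \<open>Density separates \<open>Max A\<close> from \<open>Min B\<close>; when one of the sets
  is empty, the lack of endpoints takes over.\<close>

lemma (in unbounded_dense_linorder) exists_between_finite:
  assumes "finite A" "finite B" "\<forall>a\<in>A. \<forall>b\<in>B. a < b"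
  obtains x where "\<forall>a\<in>A. a < x" "\<forall>b\<in>B. x < b"
proof (cases "A = {}"; cases "B = {}")
  assume "A = {}" "B = {}"
  then show thesis using that by auto
next
  assume ne: "A = {}" "B \<noteq> {}"
  obtain x where "x < Min B" using lt_ex by blast
  then show thesis using that[of x] ne assms(2) by auto
next
  assume ne: "A \<noteq> {}" "B = {}"
  obtain x where "Max A < x" using gt_ex by blast
  then show thesis using that[of x] ne assms(1) by auto
next
  assume ne: "A \<noteq> {}" "B \<noteq> {}"
  then have "Max A < Min B" using assms by auto
  then obtain x where "Max A < x" "x < Min B" using dense by blast
  then show thesis using that[of x] ne assms(1,2) by auto
qed

text \<open>A relation rather than a function, so that the converse swaps the two orders. When
  \<open>R\<close> and \<open>S\<close> are strict linear orders, the equivalence already makes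
  \<open>P\<close> single-valued and injective.\<close>

definition partial_iso :: "('a \<Rightarrow> 'a \<Rightarrow> bool) \<Rightarrow> ('b \<Rightarrow> 'b \<Rightarrow> bool) \<Rightarrow> ('a \<times> 'b) set \<Rightarrow> bool" where
  "partial_iso R S P \<longleftrightarrow> (\<forall>(a, b)\<in>P. \<forall>(a', b')\<in>P. R a a' \<longleftrightarrow> S b b')"

lemma partial_iso_converse: "partial_iso S R (P\<inverse>) \<longleftrightarrow> partial_iso R S P"
  unfolding partial_iso_def by fastforce

text \<open>The image of \<open>x\<close> must lie above the images \<open>L\<close> of the points
  below \<open>x\<close> and below the images \<open>U\<close> of the points above it. Both sets are
  finite, so the target order has room for it.\<close>

lemma partial_iso_extend:
  assumes "class.linorder leA lsA" "class.unbounded_dense_linorder leB lsB"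
    and P: "finite P" "partial_iso lsA lsB P"
  obtains y where "partial_iso lsA lsB (insert (x, y) P)"
proof (cases "x \<in> Domain P")
  case True
  then obtain y where "(x, y) \<in> P" by blast
  then show thesis using that[of y] P by (simp add: insert_absorb)
next
  case False
  interpret A: linorder leA lsA by fact
  interpret B: unbounded_dense_linorder leB lsB by fact
  have P': "lsA a a' \<longleftrightarrow> lsB b b'" if "(a, b) \<in> P" "(a', b') \<in> P" for a b a' b'
    using P(2) that unfolding partial_iso_def by blast
  define L where "L = snd ` {p \<in> P. lsA (fst p) x}"
  define U where "U = snd ` {p \<in> P. lsA x (fst p)}"
  have "finite L" "finite U" using P(1) by (auto simp: L_def U_def)
  moreover have "\<forall>a\<in>L. \<forall>b\<in>U. lsB a b"
    unfolding L_def U_def by (fastforce simp flip: P' dest: A.less_trans)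
  ultimately obtain y where y: "\<forall>a\<in>L. lsB a y" "\<forall>b\<in>U. lsB y b"
    by (rule B.exists_between_finite)
  have "(lsA a x \<longleftrightarrow> lsB b y) \<and> (lsA x a \<longleftrightarrow> lsB y b)" if "(a, b) \<in> P" for a b
  proof -
    have "a \<noteq> x" using that False by blast
    then consider "lsA a x" | "lsA x a" using A.less_linear by blast
    then show ?thesis
    proof cases
      case 1
      then have "b \<in> L" using that unfolding L_def by force
      then show ?thesis using 1 y(1) by (meson A.less_asym B.less_asym)
    next
      case 2
      then have "b \<in> U" using that unfolding U_def by force
      then show ?thesis using 2 y(2) by (meson A.less_asym B.less_asym)
    qed
  qed
  then have "partial_iso lsA lsB (insert (x, y) P)"
    using P(2) unfolding partial_iso_def by (auto split: prod.splits)
  then show thesis by (rule that)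
qed

text \<open>Back and forth: stage \<open>n\<close> puts the \<open>n\<close>-th element of each type
  into a finite partial isomorphism, and the union of the chain is the graph of
  \<open>h\<close>.\<close>

lemma cantor_dense_order_isomorphism:
  fixes leA lsA :: "'a \<Rightarrow> 'a \<Rightarrow> bool" and leB lsB :: "'b \<Rightarrow> 'b \<Rightarrow> bool"
  assumes A: "class.unbounded_dense_linorder leA lsA" "countable (UNIV :: 'a set)"
    and B: "class.unbounded_dense_linorder leB lsB" "countable (UNIV :: 'b set)"
  shows "\<exists>h. bij h \<and> (\<forall>x y. leA x y \<longleftrightarrow> leB (h x) (h y))"
proof -
  interpret A: unbounded_dense_linorder leA lsA by fact
  interpret B: unbounded_dense_linorder leB lsB by fact
  let ?a = "from_nat_into (UNIV :: 'a set)" and ?b = "from_nat_into (UNIV :: 'b set)"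
  let ?good = "\<lambda>P. finite P \<and> partial_iso lsA lsB P"
  have step: "\<exists>Q. ?good Q \<and> (P \<subseteq> Q \<and> ?a n \<in> Domain Q \<and> ?b n \<in> Range Q)" if good: "?good P" for P n
  proof -
    obtain y where y: "partial_iso lsA lsB (insert (?a n, y) P)"
      using partial_iso_extend[OF A.linorder_axioms B(1)] good by metis
    \<comment> \<open>The back half: taking converses exchanges the two orders, so the same
      extension lemma supplies a preimage of \<open>?b n\<close>.\<close>
    then have "partial_iso lsB lsA ((insert (?a n, y) P)\<inverse>)"
      by (simp only: partial_iso_converse)
    then obtain x where "partial_iso lsB lsA (insert (?b n, x) ((insert (?a n, y) P)\<inverse>))"
      using partial_iso_extend[OF B.linorder_axioms A(1)] good by (metis finite_converse finite_insert)
    also have "insert (?b n, x) ((insert (?a n, y) P)\<inverse>) = ({(x, ?b n), (?a n, y)} \<union> P)\<inverse>"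
      by auto
    finally show ?thesis
      using good unfolding partial_iso_converse
      by (intro exI[of _ "{(x, ?b n), (?a n, y)} \<union> P"]) auto
  qed
  have "?good {}" by (simp add: partial_iso_def)
  then obtain P where P: "\<And>n. ?good (P n)"
      and S: "\<And>n. P n \<subseteq> P (Suc n) \<and> ?a n \<in> Domain (P (Suc n)) \<and> ?b n \<in> Range (P (Suc n))"
    using dependent_nat_choice[of "\<lambda>_. ?good" "\<lambda>n P Q. P \<subseteq> Q \<and> ?a n \<in> Domain Q \<and> ?b n \<in> Range Q"] step
    by metis
  have mono: "mono P" using S by (simp add: mono_iff_le_Suc)
  define H where "H = (\<Union>n. P n)"
  have iso: "lsA a a' \<longleftrightarrow> lsB b b'" if ab: "(a, b) \<in> H" "(a', b') \<in> H" for a a' b b'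
  proof -
    obtain m n where "(a, b) \<in> P m" "(a', b') \<in> P n" using ab unfolding H_def by blast
    then have "(a, b) \<in> P (max m n)" "(a', b') \<in> P (max m n)"
      using monoD[OF mono] by (meson max.cobounded1 max.cobounded2 subsetD)+
    then show ?thesis using P unfolding partial_iso_def by blast
  qed
  have dom: "\<exists>y. (x, y) \<in> H" for x
    using S[of "to_nat_on UNIV x"] A(2) unfolding H_def by auto
  have ran: "\<exists>x. (x, y) \<in> H" for y
    using S[of "to_nat_on UNIV y"] B(2) unfolding H_def by auto
  obtain h where h: "\<And>x. (x, h x) \<in> H" using dom by metis
  have le: "leA x y \<longleftrightarrow> leB (h x) (h y)" for x y
    using iso[OF h h] by (metis A.not_less B.not_less)
  have "inj h" by (rule injI) (metis A.order.eq_iff B.order.refl le)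
  \<comment> \<open>If \<open>(x, y)\<close> and \<open>(x, h x)\<close> both lie in
    \<open>H\<close>, irreflexivity at \<open>x\<close> excludes a strict comparison of
    \<open>y\<close> with \<open>h x\<close>, so they agree.\<close>
  moreover have "surj h"
    unfolding surj_def by (metis A.less_irrefl B.neq_iff h iso ran)
  ultimately show ?thesis using le by (auto simp: bij_def)
qed

section \<open>Axioms for the minimum of a dense linear order without endpoints\<close>

text \<open>Here \<open>F a b = a\<close> plays the role of \<open>a \<le> b\<close>. Being
  first-order in \<open>F\<close>, the axioms define a measurable set of structures on
  \<open>nat\<close>, whereas \<open>op_isomorphic\<close> quantifies over uncountably many
  bijections.\<close>

definition dense_min_op :: "('a \<Rightarrow> 'a \<Rightarrow> 'a) \<Rightarrow> bool" where
  "dense_min_op F \<longleftrightarrow>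
     (\<forall>a b. F a b = F b a) \<and> (\<forall>a b. F a b = a \<or> F a b = b) \<and>
     (\<forall>a b c. F a b = a \<longrightarrow> F b c = b \<longrightarrow> F a c = a) \<and>
     (\<forall>a. \<exists>b. b \<noteq> a \<and> F a b = b) \<and> (\<forall>a. \<exists>b. b \<noteq> a \<and> F a b = a) \<and>
     (\<forall>a b. a \<noteq> b \<longrightarrow> F a b = a \<longrightarrow> (\<exists>c. c \<noteq> a \<and> c \<noteq> b \<and> F a c = a \<and> F c b = c))"

lemma dense_min_op_linorder:
  assumes "dense_min_op F"
  shows "class.unbounded_dense_linorder (\<lambda>x y. F x y = x) (\<lambda>x y. F x y = x \<and> x \<noteq> y)"
proof -
  have comm: "F a b = F b a" and sel: "F a b = a \<or> F a b = b"
    and tr: "F a b = a \<Longrightarrow> F b c = b \<Longrightarrow> F a c = a"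
    and bot: "\<exists>b. b \<noteq> a \<and> F a b = b" and top: "\<exists>b. b \<noteq> a \<and> F a b = a"
    and dense: "a \<noteq> b \<Longrightarrow> F a b = a \<Longrightarrow> \<exists>c. c \<noteq> a \<and> c \<noteq> b \<and> F a c = a \<and> F c b = c" for a b c
    using assms unfolding dense_min_op_def by blast+
  show ?thesis
  proof
    show "\<exists>z. (F x z = x \<and> x \<noteq> z) \<and> F z y = z \<and> z \<noteq> y" if xy: "F x y = x \<and> x \<noteq> y" for x y
    proof -
      obtain z where "z \<noteq> x" "z \<noteq> y" "F x z = x" "F z y = z" using dense[of x y] xy by blast
      then show ?thesis by (intro exI[of _ z]) auto
    qed
    show "\<exists>y. F x y = x \<and> x \<noteq> y" for x using top[of x] by (auto simp: eq_commute)
    show "\<exists>y. F y x = y \<and> y \<noteq> x" for x using bot[of x] comm[of x] by auto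
    show "F x x = x" for x using sel[of x x] by blast
    show "F x z = x" if "F x y = x" "F y z = y" for x y z by (rule tr[OF that])
    show eq: "x = y" if "F x y = x" "F y x = y" for x y using comm[of x y] that by simp
    show "F x y = x \<or> F y x = y" for x y using sel[of x y] comm[of x y] by simp
    show "(F x y = x \<and> x \<noteq> y) \<longleftrightarrow> F x y = x \<and> F y x \<noteq> y" for x y
      using comm[of x y] sel[of x y] by auto
  qed
qed

lemma dense_min_op_min: "dense_min_op (min :: 'a \<Rightarrow> 'a \<Rightarrow> 'a :: unbounded_dense_linorder)"
proof -
  have bot: "\<exists>b. b \<noteq> a \<and> min a b = b" for a :: 'a
    using lt_ex[of a] by (auto simp: min_def intro: less_imp_le)
  have top: "\<exists>b. b \<noteq> a \<and> min a b = a" for a :: 'a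
    using gt_ex[of a] by (auto simp: min_def intro: less_imp_le)
  have dense: "\<exists>c. c \<noteq> a \<and> c \<noteq> b \<and> min a c = a \<and> min c b = c" if "a \<noteq> b" "min a b = a" for a b :: 'a
  proof -
    have "a < b" using that by (metis min.absorb_iff1 order.not_eq_order_implies_strict)
    then obtain c where "a < c" "c < b" using dense by blast
    then show ?thesis by (intro exI[of _ c]) auto
  qed
  have "min a b = a \<or> min a b = b" for a b :: 'a by (auto simp: min_def)
  moreover have "min a c = a" if "min a b = a" "min b c = b" for a b c :: 'a
    using that by (metis min.assoc)
  ultimately show ?thesis
    unfolding dense_min_op_def by (intro conjI allI impI bot top dense min.commute)
qed

lemma op_isomorphic_sym: "op_isomorphic f g \<Longrightarrow> op_isomorphic g f"
  unfolding op_isomorphic_def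
proof (elim exE conjE)
  fix h assume h: "bij h" "\<forall>x y. h (f x y) = g (h x) (h y)"
  then have "inv h (g x y) = f (inv h x) (inv h y)" for x y
    by (metis bij_inv_eq_iff)
  then show "\<exists>k. bij k \<and> (\<forall>x y. k (g x y) = f (k x) (k y))"
    using bij_imp_bij_inv[OF h(1)] by blast
qed

lemma op_isomorphic_trans: "op_isomorphic f g \<Longrightarrow> op_isomorphic g k \<Longrightarrow> op_isomorphic f k"
  unfolding op_isomorphic_def
proof (elim exE conjE)
  fix h h' assume "bij h" "\<forall>x y. h (f x y) = g (h x) (h y)" "bij h'" "\<forall>x y. h' (g x y) = k (h' x) (h' y)"
  then show "\<exists>h. bij h \<and> (\<forall>x y. h (f x y) = k (h x) (h y))"
    by (intro exI[of _ "h' \<circ> h"]) (simp add: bij_comp)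
qed

text \<open>Places the isomorphism class of \<open>min\<close> inside the measurable set given by
  \<open>dense_min_op\<close>.\<close>

lemma op_isomorphic_dense_min_op:
  assumes "op_isomorphic f g" "dense_min_op f"
  shows "dense_min_op g"
proof -
  obtain k where k: "bij k" "\<And>x y. k (g x y) = f (k x) (k y)"
    using op_isomorphic_sym[OF assms(1)] unfolding op_isomorphic_def by blast
  obtain h where h: "\<And>x. k (h x) = x" "\<And>x. h (k x) = x"
    using k(1) by (metis bij_inv_eq_iff)
  have g: "g x y = h (f (k x) (k y))" for x y using h(2) k(2) by metis
  have hk: "h a = y \<longleftrightarrow> a = k y" for a y using h by metis
  have f: "f a b = f b a" "f a b = a \<or> f a b = b"
    "f a b = a \<Longrightarrow> f b c = b \<Longrightarrow> f a c = a"
    "\<exists>b. b \<noteq> a \<and> f a b = b" "\<exists>b. b \<noteq> a \<and> f a b = a"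
    "a \<noteq> b \<Longrightarrow> f a b = a \<Longrightarrow> \<exists>c. c \<noteq> a \<and> c \<noteq> b \<and> f a c = a \<and> f c b = c" for a b c
    using assms(2) unfolding dense_min_op_def by blast+
  show ?thesis
    unfolding dense_min_op_def
  proof (intro conjI allI impI)
    fix a b c
    show "g a b = g b a" unfolding g using f(1) by simp
    show "g a b = a \<or> g a b = b" unfolding g hk by (rule f(2))
    show "g a c = a" if "g a b = a" "g b c = b" using that f(3) unfolding g hk by blast
    obtain x where "x \<noteq> k a" "f (k a) x = x" using f(4) by blast
    then show "\<exists>b. b \<noteq> a \<and> g a b = b" unfolding g hk by (intro exI[of _ "h x"]) (simp add: h hk)
    obtain y where "y \<noteq> k a" "f (k a) y = k a" using f(5) by blast
    then show "\<exists>b. b \<noteq> a \<and> g a b = a" unfolding g hk by (intro exI[of _ "h y"]) (simp add: h hk)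
    assume "a \<noteq> b" "g a b = a"
    then have "k a \<noteq> k b" "f (k a) (k b) = k a" unfolding g hk using h(2) by metis+
    then obtain z where "z \<noteq> k a" "z \<noteq> k b" "f (k a) z = k a" "f z (k b) = z" using f(6) by blast
    then show "\<exists>c. c \<noteq> a \<and> c \<noteq> b \<and> g a c = a \<and> g c b = c"
      unfolding g hk by (intro exI[of _ "h z"]) (simp add: h hk)
  qed
qed

text \<open>Cantor's theorem gives an order isomorphism \<open>h\<close>. It respects the operations
  as well, because each value is whichever argument is smaller.\<close>

lemma dense_min_op_isomorphic:
  fixes F :: "'a \<Rightarrow> 'a \<Rightarrow> 'a" and G :: "'b \<Rightarrow> 'b \<Rightarrow> 'b"
  assumes F: "dense_min_op F" "countable (UNIV :: 'a set)"
    and G: "dense_min_op G" "countable (UNIV :: 'b set)"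
  shows "op_isomorphic F G"
proof -
  obtain h where "bij h" and le: "\<forall>x y. F x y = x \<longleftrightarrow> G (h x) (h y) = h x"
    using cantor_dense_order_isomorphism[OF dense_min_op_linorder[OF F(1)] F(2)
        dense_min_op_linorder[OF G(1)] G(2)] by blast
  have comm: "F x y = F y x" "G a b = G b a" and sel: "F x y = x \<or> F x y = y" "G a b = a \<or> G a b = b"
    for x y a b using F(1) G(1) unfolding dense_min_op_def by simp_all
  have "h (F x y) = G (h x) (h y)" for x y
  proof (cases "F x y = x")
    case True
    then show ?thesis using le by metis
  next
    case False
    then have "F y x = y" using comm(1)[of x y] sel(1)[of x y] by simp
    moreover from this have "G (h y) (h x) = h y" using le by metis
    ultimately show ?thesis using comm(1)[of x y] comm(2)[of "h x" "h y"] by simp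
  qed
  with \<open>bij h\<close> show ?thesis unfolding op_isomorphic_def by blast
qed

section \<open>Measures invariant under the logic action\<close>

lemma space_S_L [simp]: "space S_L = UNIV"
  by (simp add: S_L_def)

lemma measurable_S_L_apply [measurable]: "(\<lambda>F. F m n) \<in> S_L \<rightarrow>\<^sub>M count_space UNIV"
  unfolding measurable_count_space_eq2_countable
proof (intro conjI ballI)
  fix l
  have "{F :: nat \<Rightarrow> nat \<Rightarrow> nat. F m n = l} \<in> sets S_L"
    unfolding S_L_def by (subst sets_measure_of) (auto intro!: sigma_sets.Basic)
  then show "(\<lambda>F. F m n) -` {l} \<inter> space S_L \<in> sets S_L"
    by (simp add: vimage_def)
qed simp

lemma measurable_into_S_L:
  assumes "\<And>m n. (\<lambda>x. G x m n) \<in> M \<rightarrow>\<^sub>M count_space UNIV"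
  shows "G \<in> M \<rightarrow>\<^sub>M S_L"
  unfolding S_L_def
proof (rule measurable_measure_of)
  fix A assume "A \<in> {{F :: nat \<Rightarrow> nat \<Rightarrow> nat. F m n = l} | m n l. True}"
  then obtain m n l where A: "A = {F. F m n = l}" by blast
  have "(\<lambda>x. G x m n) -` {l} \<inter> space M \<in> sets M"
    by (rule measurable_sets[OF assms]) simp
  then show "G -` A \<inter> space M \<in> sets M"
    by (simp add: A vimage_def)
qed auto

lemma pred_dense_min_op: "Measurable.pred S_L dense_min_op"
  unfolding dense_min_op_def by measurable

lemma logic_action_apply: "bij p \<Longrightarrow> logic_action p F (p m) (p n) = p (F m n)"
  by (simp add: logic_action_def bij_def)

text \<open>Meant for conditions that quantify over the second argument, where \<open>x\<close> is
  not displayed as an image under \<open>p\<close>.\<close>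

lemma logic_action_apply_left: "bij p \<Longrightarrow> logic_action p F (p m) x = p (F m (inv p x))"
  by (simp add: logic_action_def bij_def)

lemma logic_action_inv:
  assumes "bij p"
  shows "logic_action p (logic_action (inv p) F) = F" "logic_action (inv p) (logic_action p F) = F"
  using assms by (simp_all add: logic_action_def fun_eq_iff inv_inv_eq bij_inv_eq_iff bij_imp_bij_inv
      surj_f_inv_f bij_is_surj inv_f_f bij_is_inj)

text \<open>Turns the images in \<open>Sym_invariant\<close> into preimages, the form in which
  pushforward measures are computed.\<close>

lemma logic_action_image:
  assumes "bij p"
  shows "logic_action p ` A = logic_action (inv p) -` A"
proof (intro set_eqI iffI)
  fix F assume "F \<in> logic_action (inv p) -` A"
  then show "F \<in> logic_action p ` A"
    by (intro image_eqI[of _ _ "logic_action (inv p) F"]) (simp_all add: logic_action_inv[OF assms])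
qed (auto simp: logic_action_inv[OF assms])

text \<open>
  The events \<open>R F l\<close> for \<open>l \<notin> A\<close> are pairwise disjoint and, by the transpositions fixing \<open>A\<close>
  pointwise, equiprobable; as there are infinitely many of them, they are null.
\<close>

lemma Sym_invariant_definable_null:
  fixes R :: "(nat \<Rightarrow> nat \<Rightarrow> nat) \<Rightarrow> nat \<Rightarrow> bool"
  assumes "prob_space \<mu>" and sets: "sets \<mu> = sets S_L" and inv: "Sym_invariant \<mu>"
    and meas: "\<And>l. Measurable.pred S_L (\<lambda>F. R F l)"
    and unique: "\<And>F l l'. R F l \<Longrightarrow> R F l' \<Longrightarrow> l = l'"
    and fin: "finite A"
    and equivariant: "\<And>p F l. bij p \<Longrightarrow> \<forall>a\<in>A. p a = a \<Longrightarrow> R F l \<Longrightarrow> R (logic_action p F) (p l)"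
  shows "AE F in \<mu>. \<forall>l. l \<notin> A \<longrightarrow> \<not> R F l"
proof -
  interpret prob_space \<mu> by fact
  define E where "E l = {F. R F l}" for l
  have E [measurable]: "E l \<in> sets \<mu>" for l
    using meas[of l] unfolding E_def sets by (simp add: pred_def)
  have eq: "prob (E l) = prob (E l')" if "l \<notin> A" "l' \<notin> A" for l l'
  proof -
    let ?p = "Transposition.transpose l l'"
    have bij_p: "bij ?p" by simp
    have fix_A: "\<forall>a\<in>A. ?p a = a" using that by (auto intro!: transpose_apply_other)
    have "logic_action ?p ` E l = E l'"
    proof (intro set_eqI iffI)
      \<comment> \<open>A transposition is an involution, so acting with it again recovers
        \<open>F\<close> from a structure in \<open>E l\<close>.\<close>
      fix F assume "F \<in> E l'"
      then have "logic_action ?p F \<in> E l"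
        using equivariant[OF bij_p fix_A, of F l'] by (simp add: E_def)
      then show "F \<in> logic_action ?p ` E l"
        using logic_action_inv(1)[OF bij_p, of F] by (intro image_eqI) simp_all
    next
      fix F assume "F \<in> logic_action ?p ` E l"
      then show "F \<in> E l'"
        using equivariant[OF bij_p fix_A, of _ l] by (auto simp: E_def)
    qed
    then show ?thesis
      using inv E unfolding Sym_invariant_def measure_def by (metis bij_p)
  qed
  have "prob (E l) = 0" if l: "l \<notin> A" for l
  proof -
    have "infinite (- A)" using fin by (simp add: finite_compl)
    then obtain g :: "nat \<Rightarrow> nat" where g: "inj g" "range g \<subseteq> - A"
      using infinite_countable_subset by blast
    have "disjoint_family (\<lambda>i. E (g i))"
      unfolding disjoint_family_on_def E_def using unique injD[OF g(1)] by blast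
    moreover have "range (\<lambda>i. E (g i)) \<subseteq> events" by auto
    ultimately have "summable (\<lambda>i. prob (E (g i)))"
      using finite_measure_UNION[of "\<lambda>i. E (g i)"] by (auto simp: sums_iff)
    moreover have "prob (E (g i)) = prob (E l)" for i using g(2) l by (intro eq) auto
    ultimately have "(\<lambda>i :: nat. prob (E l)) \<longlonglongrightarrow> 0"
      using summable_LIMSEQ_zero[of "\<lambda>i. prob (E (g i))"] by simp
    then show ?thesis by (simp add: LIMSEQ_const_iff)
  qed
  then have "AE F in \<mu>. F \<notin> E l" if "l \<notin> A" for l
    using that E[of l] by (intro AE_not_in) (simp add: null_sets_def emeasure_eq_measure)
  then show ?thesis
    unfolding AE_all_countable E_def by simp
qed

section \<open>From an invariant measure to the rationals\<close>

lemma op_isomorphic_min_if_admits_invariant_measure: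
  fixes f :: "'a \<Rightarrow> 'a \<Rightarrow> 'a"
  assumes "abel_semigroup f" and "admits_invariant_measure f"
  shows "op_isomorphic f (min :: rat \<Rightarrow> rat \<Rightarrow> rat)"
proof -
  interpret f: abel_semigroup f by fact
  obtain \<mu> where "prob_space \<mu>" and sets: "sets \<mu> = sets S_L" and "Sym_invariant \<mu>"
    and iso: "emeasure \<mu> {F. op_isomorphic F f} = 1"
    using assms(2) unfolding admits_invariant_measure_def by blast
  interpret prob_space \<mu> by fact
  note null = Sym_invariant_definable_null[OF \<open>prob_space \<mu>\<close> sets \<open>Sym_invariant \<mu>\<close>]
  define comm where "comm F \<longleftrightarrow> (\<forall>a b. F a b = F b a)" for F :: "nat \<Rightarrow> nat \<Rightarrow> nat"
  have comm_action: "comm (logic_action p F)" if "comm F" for p F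
    using that by (auto simp: comm_def logic_action_def)
  have [measurable]: "Measurable.pred S_L comm"
    unfolding comm_def by measurable
  \<comment> \<open>Commutativity is built in because it makes each of these elements unique.\<close>
  define bot where "bot F l \<longleftrightarrow> comm F \<and> (\<forall>x. F l x = l)" for F :: "nat \<Rightarrow> nat \<Rightarrow> nat" and l
  define top where "top F l \<longleftrightarrow> comm F \<and> (\<forall>x. F l x = x)" for F :: "nat \<Rightarrow> nat \<Rightarrow> nat" and l
  define succ where "succ m F l \<longleftrightarrow> comm F \<and> l \<noteq> m \<and> F m l = m \<and>
      (\<forall>x. x \<noteq> m \<longrightarrow> F m x = m \<longrightarrow> F l x = l)" for F :: "nat \<Rightarrow> nat \<Rightarrow> nat" and m l
  \<comment> \<open>Measure 1 forces the isomorphism class to be measurable, as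
    \<open>emeasure\<close> vanishes off the \<sigma>-algebra.\<close>
  have "AE F in \<mu>. op_isomorphic F f"
    using iso AE_prob_1[of "{F. op_isomorphic F f}"] by (simp add: measure_def)
  \<comment> \<open>The value \<open>F m n\<close> is definable over \<open>{m, n}\<close>, so
    almost surely it is \<open>m\<close> or \<open>n\<close>; the case \<open>m = n\<close> gives
    idempotency.\<close>
  moreover have "AE F in \<mu>. \<forall>m n l. l \<notin> {m, n} \<longrightarrow> \<not> F m n = l"
    by (subst AE_all_countable, intro allI, subst AE_all_countable, intro allI, rule null)
      (auto simp flip: logic_action_apply)
  moreover have "AE F in \<mu>. \<forall>l. l \<notin> {} \<longrightarrow> \<not> bot F l"
  proof (rule null)
    show "bot (logic_action p F) (p l)" if "bij p" "bot F l" for p F l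
      using that comm_action by (auto simp: bot_def logic_action_apply_left)
    show "Measurable.pred S_L (\<lambda>F. bot F l)" for l
      unfolding bot_def by measurable
    show "l = l'" if "bot F l" "bot F l'" for F l l'
      using that unfolding bot_def comm_def by metis
  qed simp
  moreover have "AE F in \<mu>. \<forall>l. l \<notin> {} \<longrightarrow> \<not> top F l"
  proof (rule null)
    show "top (logic_action p F) (p l)" if "bij p" "top F l" for p F l
      using that comm_action by (auto simp: top_def logic_action_apply_left surj_f_inv_f bij_is_surj)
    show "Measurable.pred S_L (\<lambda>F. top F l)" for l
      unfolding top_def by measurable
    show "l = l'" if "top F l" "top F l'" for F l l'
      using that unfolding top_def comm_def by metis
  qed simp
  \<comment> \<open>The parameter \<open>m\<close> enters the definition of the successor, so
    equivariance is checked only for bijections fixing \<open>m\<close>.\<close>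
  moreover have "AE F in \<mu>. \<forall>m l. l \<notin> {m} \<longrightarrow> \<not> succ m F l"
  proof (subst AE_all_countable, intro allI, rule null)
    fix m
    show "succ m (logic_action p F) (p l)"
      if p: "bij p" and m: "\<forall>a\<in>{m}. p a = a" and succ: "succ m F l" for p F l
    proof -
      have inv_eq: "inv p x = y \<longleftrightarrow> x = p y" for x y using p bij_inv_eq_iff by metis
      have pm: "p m = m" using m by simp
      then have inv: "inv p m = m" "inv p x = m \<longleftrightarrow> x = m" for x by (simp_all add: inv_eq)
      have left: "logic_action p F m x = p (F m (inv p x))" for x
        using logic_action_apply_left[OF p, of F m] pm by simp
      have pe: "p x = m \<longleftrightarrow> x = m" for x
        using p pm by (metis inv_eq inv(1))
      show ?thesis
        using succ comm_action[of F p] p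
        by (simp add: succ_def logic_action_apply_left left inv pe bij_is_inj)
    qed
    show "Measurable.pred S_L (\<lambda>F. succ m F l)" for l
      unfolding succ_def by measurable
    \<comment> \<open>Minimality of each candidate gives \<open>F l l' = l\<close> and
      \<open>F l' l = l'\<close>, and commutativity identifies the two.\<close>
    show "l = l'" if "succ m F l" "succ m F l'" for F l l'
      using that unfolding succ_def comm_def by metis
  qed simp
  ultimately have "AE F in \<mu>. op_isomorphic F f \<and> (\<forall>m n. F m n = m \<or> F m n = n) \<and>
      (\<forall>l. \<not> bot F l) \<and> (\<forall>l. \<not> top F l) \<and> (\<forall>m l. l \<noteq> m \<longrightarrow> \<not> succ m F l)"
    by eventually_elim auto
  \<comment> \<open>An event of probability 1 is nonempty. One such \<open>F\<close> is enough,
    since it is itself isomorphic to \<open>f\<close>.\<close>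
  then have "\<exists>F. op_isomorphic F f \<and> (\<forall>m n. F m n = m \<or> F m n = n) \<and>
      (\<forall>l. \<not> bot F l) \<and> (\<forall>l. \<not> top F l) \<and> (\<forall>m l. l \<noteq> m \<longrightarrow> \<not> succ m F l)"
    by (rule eventually_happens'[OF ae_filter_bot])
  then obtain F where F_iso: "op_isomorphic F f" and FS: "\<forall>a b. F a b = a \<or> F a b = b"
    and F_no_bot: "\<forall>l. \<not> bot F l" and F_no_top: "\<forall>l. \<not> top F l"
    and F_no_succ: "\<forall>m l. l \<noteq> m \<longrightarrow> \<not> succ m F l"
    by (elim exE conjE)
  obtain h where "bij h" and h: "\<And>x y. h (F x y) = f (h x) (h y)"
    using F_iso unfolding op_isomorphic_def by blast
  then have inj: "h x = h y \<longleftrightarrow> x = y" for x y by (simp add: bij_def inj_eq)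
  \<comment> \<open>The algebraic laws come from the isomorphism with \<open>f\<close>; the measure
    has supplied the rest.\<close>
  have FC: "F a b = F b a" for a b
    by (simp add: f.commute h flip: inj)
  then have F_comm: "comm F" unfolding comm_def by blast
  have FA: "F (F a b) c = F a (F b c)" for a b c
    by (simp add: f.assoc h flip: inj)
  have "dense_min_op F"
    unfolding dense_min_op_def
  proof (intro conjI allI impI FC FS[rule_format])
    fix a b c
    show "F a c = a" if "F a b = a" "F b c = b" using FA[of a b c] that by simp
    have "\<not> (\<forall>x. F a x = a)" using F_no_bot F_comm by (simp add: bot_def)
    then show "\<exists>b. b \<noteq> a \<and> F a b = b" using FS by metis
    have "\<not> (\<forall>x. F a x = x)" using F_no_top F_comm by (simp add: top_def)
    then show "\<exists>b. b \<noteq> a \<and> F a b = a" using FS by metis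
    assume ab: "a \<noteq> b" "F a b = a"
    \<comment> \<open>As \<open>b\<close> is not an immediate successor of \<open>a\<close>, some
      \<open>x\<close> above \<open>a\<close> has \<open>F b x \<noteq> b\<close>. Then
      \<open>F b x = x\<close>, and \<open>x\<close> lies strictly between \<open>a\<close> and
      \<open>b\<close>.\<close>
    have "\<not> (\<forall>x. x \<noteq> a \<longrightarrow> F a x = a \<longrightarrow> F b x = b)"
    proof
      assume "\<forall>x. x \<noteq> a \<longrightarrow> F a x = a \<longrightarrow> F b x = b"
      then have "succ a F b" using ab F_comm by (auto simp: succ_def)
      moreover have "\<not> succ a F b" using F_no_succ ab(1) by simp
      ultimately show False by contradiction
    qed
    then obtain x where "x \<noteq> a" "F a x = a" "F b x \<noteq> b" by auto
    then show "\<exists>c. c \<noteq> a \<and> c \<noteq> b \<and> F a c = a \<and> F c b = c"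
      using FS FC[of b x] by (intro exI[of _ x]) auto
  qed
  then have "op_isomorphic F (min :: rat \<Rightarrow> rat \<Rightarrow> rat)"
    by (intro dense_min_op_isomorphic dense_min_op_min) auto
  moreover have "op_isomorphic f F" using F_iso by (rule op_isomorphic_sym)
  ultimately show ?thesis by (rule op_isomorphic_trans[rotated])
qed

section \<open>The order induced by an i.i.d. sequence\<close>

text \<open>
  Ties are broken towards the first argument, not towards the smaller index, so that
  \<open>logic_action_index_min\<close> holds for every \<open>U\<close> and not only for injective ones.
\<close>

definition index_min :: "(nat \<Rightarrow> real) \<Rightarrow> nat \<Rightarrow> nat \<Rightarrow> nat" where
  "index_min U m n = (if U m \<le> U n then m else n)"

text \<open>Permuting the structure amounts to permuting the coordinates of \<open>U\<close>, which
  preserves the law of an i.i.d. sequence.\<close>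

lemma logic_action_index_min:
  assumes "bij p"
  shows "logic_action p (index_min U) = index_min (\<lambda>n. U (inv p n))"
  using assms by (auto simp: logic_action_def index_min_def fun_eq_iff surj_f_inv_f bij_is_surj)

text \<open>Rational endpoints suffice because two rationals fit between any two reals; they keep
  the density condition a countable intersection of events.\<close>

lemma dense_min_op_index_min:
  assumes inj: "\<And>m n. m \<noteq> n \<Longrightarrow> U m \<noteq> U n"
    and dense: "\<And>a b. a \<in> \<rat> \<Longrightarrow> b \<in> \<rat> \<Longrightarrow> a < b \<Longrightarrow> \<exists>k. U k \<in> {a<..<b}"
  shows "dense_min_op (index_min U)"
proof -
  have between: "\<exists>k. x < U k \<and> U k < y" if xy: "x < y" for x y
  proof -
    obtain a where a: "a \<in> \<rat>" "x < a" "a < y" using Rats_dense_in_real[OF xy] by blast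
    obtain b where "b \<in> \<rat>" "a < b" "b < y" using Rats_dense_in_real[OF a(3)] by blast
    then show ?thesis using dense[of a b] a by (auto intro: less_trans)
  qed
  show ?thesis
    unfolding dense_min_op_def
  proof (intro conjI allI impI)
    fix m n l
    show "index_min U m n = index_min U n m" using inj[of m n] by (auto simp: index_min_def)
    show "index_min U m n = m \<or> index_min U m n = n" by (simp add: index_min_def)
    show "index_min U m l = m" if "index_min U m n = m" "index_min U n l = n"
      using that by (auto simp: index_min_def split: if_splits)
    obtain k where "U k < U m" using between[of "U m - 1" "U m"] by auto
    then show "\<exists>k. k \<noteq> m \<and> index_min U m k = k" by (intro exI[of _ k]) (auto simp: index_min_def)
    obtain k where "U m < U k" using between[of "U m" "U m + 1"] by auto
    then show "\<exists>k. k \<noteq> m \<and> index_min U m k = m" by (intro exI[of _ k]) (auto simp: index_min_def)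
    assume "m \<noteq> n" "index_min U m n = m"
    then have "U m < U n" using inj[of m n] by (auto simp: index_min_def split: if_splits)
    then obtain k where "U m < U k" "U k < U n" using between by blast
    then show "\<exists>k. k \<noteq> m \<and> k \<noteq> n \<and> index_min U m k = m \<and> index_min U k n = k"
      by (intro exI[of _ k]) (auto simp: index_min_def)
  qed
qed

section \<open>Almost sure injectivity and density of an i.i.d. sequence\<close>

lemma AE_std_normal_neq: "AE x in std_normal_distribution. x \<noteq> c"
  using AE_lborel_singleton[of c] by (subst AE_density) auto

text \<open>The normal density is positive everywhere, so an interval of probability 0 would be
  Lebesgue null. The complement is the set whose powers of probability tend to 0 in
  \<open>AE_hits\<close>.\<close>

lemma std_normal_interval_complement:
  assumes "a < b"
  shows "measure std_normal_distribution (- {a<..<b}) < 1"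
proof -
  interpret prob_space std_normal_distribution by (rule prob_space_normal_density) simp
  have "prob {a<..<b} \<noteq> 0"
  proof
    assume "prob {a<..<b} = 0"
    then have "AE x in std_normal_distribution. x \<notin> {a<..<b}"
      by (intro AE_not_in) (simp add: null_sets_def emeasure_eq_measure)
    then have "AE x in lborel. x \<notin> {a<..<b}"
      by (subst (asm) AE_density) (auto simp: normal_density_pos)
    then have "emeasure lborel {a<..<b} = 0"
      by (subst (asm) AE_iff_measurable[of "{a<..<b}"]) auto
    then show False using assms by simp
  qed
  moreover have "prob (- {a<..<b}) = 1 - prob {a<..<b}"
    using prob_compl[of "{a<..<b}"] by (simp add: Compl_eq_Diff_UNIV)
  ultimately show ?thesis by (simp add: zero_less_measure_iff)
qed

text \<open>Two distinct coordinates have joint law \<open>M \<Otimes>\<^sub>M M\<close>, and by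
  Fubini the diagonal is null because each of its sections is a null point.\<close>

lemma (in sequence_space) AE_neq:
  assumes "\<And>c. AE x in M. x \<noteq> c" and diag: "Measurable.pred (M \<Otimes>\<^sub>M M) (\<lambda>(x, y). y \<noteq> x)" and "m \<noteq> n"
  shows "AE U in S. U m \<noteq> U n"
proof -
  have eq: "M \<Otimes>\<^sub>M M = distr S (M \<Otimes>\<^sub>M M) (\<lambda>U. (U m, U n))"
  proof (rule pair_measure_eqI)
    fix A B assume AB: "A \<in> sets M" "B \<in> sets M"
    define X where "X i = (if i = m then A else B)" for i
    have "(\<lambda>U. (U m, U n)) -` (A \<times> B) \<inter> space S = {U \<in> space S. \<forall>i\<in>{m, n}. U i \<in> X i}"
      using \<open>m \<noteq> n\<close> by (auto simp: X_def)
    also have "emeasure S \<dots> = (\<Prod>i\<in>{m, n}. emeasure M (X i))"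
      using AB by (intro emeasure_PiM_Collect) (auto simp: X_def)
    finally show "emeasure M A * emeasure M B = emeasure (distr S (M \<Otimes>\<^sub>M M) (\<lambda>U. (U m, U n))) (A \<times> B)"
      using AB \<open>m \<noteq> n\<close> by (subst emeasure_distr) (auto simp: X_def)
  qed (simp_all add: M.sigma_finite_measure_axioms)
  interpret pair_sigma_finite M M ..
  have "AE z in M \<Otimes>\<^sub>M M. case z of (x, y) \<Rightarrow> y \<noteq> x"
    using diag assms(1) by (intro AE_pair_measure) (auto simp: pred_def)
  then have "AE z in distr S (M \<Otimes>\<^sub>M M) (\<lambda>U. (U m, U n)). case z of (x, y) \<Rightarrow> y \<noteq> x"
    by (subst (asm) eq)
  then show ?thesis
    by (rule AE_mp[OF AE_distrD[rotated]]) auto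
qed

text \<open>By independence, the probability that all coordinates miss \<open>A\<close> is a limit
  of powers of a number below 1.\<close>

lemma (in sequence_space) AE_hits:
  assumes A: "A \<in> sets M" and "measure M (space M - A) < 1"
  shows "AE U in S. \<exists>k. U k \<in> A"
proof -
  let ?E = "\<lambda>_ :: nat. space M - A"
  have "(\<lambda>n. \<Prod>i\<le>n. measure M (?E i)) \<longlonglongrightarrow> measure S (Pi UNIV ?E)"
    by (intro measure_PiM_countable) (use A in auto)
  \<comment> \<open>The product over \<open>i \<le> n\<close> has \<open>n + 1\<close> factors,
    hence the shift by \<open>LIMSEQ_Suc\<close>.\<close>
  moreover have "(\<lambda>n. \<Prod>i\<le>n. measure M (?E i)) \<longlonglongrightarrow> 0"
    using LIMSEQ_Suc[OF LIMSEQ_power_zero[of "measure M (space M - A)"]] assms(2) by simp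
  ultimately have "measure S (Pi UNIV ?E) = 0" by (rule LIMSEQ_unique)
  moreover have "Pi UNIV ?E \<in> sets S" by (intro infprod_in_sets) (use A in auto)
  ultimately have "AE U in S. U \<notin> Pi UNIV ?E"
    by (intro AE_not_in) (simp add: null_sets_def emeasure_eq_measure)
  then show ?thesis
    using AE_space by eventually_elim (auto simp: space_PiM Pi_iff)
qed

section \<open>The invariant measure obtained from the induced order\<close>

lemma admits_invariant_measure_if_op_isomorphic_min:
  assumes "op_isomorphic f (min :: rat \<Rightarrow> rat \<Rightarrow> rat)"
  shows "admits_invariant_measure f"
proof -
  let ?N = std_normal_distribution
  interpret N: prob_space ?N by (rule prob_space_normal_density) simp
  interpret sequence_space ?N ..
  have coord [measurable]: "(\<lambda>U. U n) \<in> borel_measurable S" for n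
    using measurable_component_singleton[of n UNIV "\<lambda>_. ?N"] by simp
  have index_min [measurable]: "index_min \<in> S \<rightarrow>\<^sub>M S_L"
    by (rule measurable_into_S_L) (unfold index_min_def, measurable)
  define \<mu> where "\<mu> = distr S S_L index_min"
  have sets [measurable_cong]: "sets \<mu> = sets S_L" by (simp add: \<mu>_def)
  have "prob_space \<mu>" unfolding \<mu>_def by (rule prob_space_distr) simp
  have "Sym_invariant \<mu>"
    unfolding Sym_invariant_def
  proof (intro allI impI ballI)
    fix p :: "nat \<Rightarrow> nat" and A
    assume p: "bij p" and A: "A \<in> sets \<mu>"
    have act: "logic_action (inv p) \<in> S_L \<rightarrow>\<^sub>M S_L"
      by (rule measurable_into_S_L) (unfold logic_action_def, measurable)
    have reindex: "(\<lambda>U n. U (p n)) \<in> S \<rightarrow>\<^sub>M S"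
      by (rule measurable_PiM_single') (auto simp: space_PiM)
    \<comment> \<open>Reindexing i.i.d. coordinates along the injection \<open>p\<close> preserves
      their joint law. On structures this becomes the action of \<open>inv p\<close>.\<close>
    have "\<mu> = distr (distr S S (\<lambda>U n. U (p n))) S_L index_min"
      using distr_PiM_reindex[of UNIV "\<lambda>_. ?N" p UNIV] p N.prob_space_axioms
      by (simp add: \<mu>_def bij_is_inj restrict_UNIV)
    also have "\<dots> = distr S S_L (\<lambda>U. logic_action (inv p) (index_min U))"
      using reindex p by (simp add: distr_distr comp_def logic_action_index_min bij_imp_bij_inv inv_inv_eq)
    also have "\<dots> = distr \<mu> S_L (logic_action (inv p))"
      using act by (simp add: \<mu>_def distr_distr comp_def)
    finally have "emeasure \<mu> A = emeasure (distr \<mu> S_L (logic_action (inv p))) A" by simp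
    also have "\<dots> = emeasure \<mu> (logic_action (inv p) -` A)"
      using act A sets by (subst emeasure_distr) (simp_all add: \<mu>_def)
    finally show "emeasure \<mu> (logic_action p ` A) = emeasure \<mu> A"
      by (simp add: logic_action_image[OF p])
  qed
  moreover have "emeasure \<mu> {F. op_isomorphic F f} = 1"
  proof -
    \<comment> \<open>Axiomatizing the isomorphism class makes it measurable and reduces the claim
      to almost sure properties of \<open>U\<close>.\<close>
    have class_eq: "{F :: nat \<Rightarrow> nat \<Rightarrow> nat. op_isomorphic F f} = {F. dense_min_op F}"
    proof (intro Collect_cong iffI)
      fix F :: "nat \<Rightarrow> nat \<Rightarrow> nat"
      show "dense_min_op F" if "op_isomorphic F f"
        using op_isomorphic_dense_min_op[OF op_isomorphic_sym[OF op_isomorphic_trans[OF that assms]]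
          dense_min_op_min] .
      show "op_isomorphic F f" if "dense_min_op F"
        by (rule op_isomorphic_trans[OF dense_min_op_isomorphic op_isomorphic_sym[OF assms]])
          (use that dense_min_op_min in auto)
    qed
    have hit: "AE U in S. \<exists>k. U k \<in> {a<..<b}" if "a < b" for a b
      using std_normal_interval_complement[OF that] by (intro AE_hits) (simp_all add: Compl_eq_Diff_UNIV)
    have "AE U in S. \<forall>m n. m \<noteq> n \<longrightarrow> U m \<noteq> U n"
      unfolding AE_all_countable
      by (auto intro!: AE_neq AE_std_normal_neq)
    moreover have "AE U in S. \<forall>a\<in>\<rat>. \<forall>b\<in>\<rat>. a < b \<longrightarrow> (\<exists>k. U k \<in> {a<..<b})"
      by (intro AE_ball_countable' countable_rat AE_impI hit)
    ultimately have "AE U in S. dense_min_op (index_min U)"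
      by eventually_elim (auto intro!: dense_min_op_index_min)
    then have "AE F in \<mu>. dense_min_op F"
      unfolding \<mu>_def using pred_dense_min_op by (subst AE_distr_iff) (auto simp: pred_def)
    then show ?thesis
      unfolding class_eq
      using prob_space.emeasure_eq_1_AE[OF \<open>prob_space \<mu>\<close>, of "{F. dense_min_op F}"] pred_dense_min_op sets
      by (simp add: pred_def)
  qed
  ultimately show ?thesis
    using \<open>prob_space \<mu>\<close> sets unfolding admits_invariant_measure_def by blast
qed

theorem theorem6p1:
  fixes f :: "'a \<Rightarrow> 'a \<Rightarrow> 'a"
  assumes "abel_semigroup f"
    and "countable (UNIV :: 'a set)" and "infinite (UNIV :: 'a set)"
  shows "admits_invariant_measure f \<longleftrightarrow> op_isomorphic f (min :: rat \<Rightarrow> rat \<Rightarrow> rat)"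
  using op_isomorphic_min_if_admits_invariant_measure[OF assms(1)]
    admits_invariant_measure_if_op_isomorphic_min by blast

end
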